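(* For every integer $n\geq 5$, the signed Roman domination number of the graph $A_n$ satisfies $\gamma_{sR}(A_n)=0$.
   Context: Graphs are finite, undirected and simple. For a vertex $v$ of a graph $G=(V,E)$, $N(v)=\{u\in V\mid uv\in E\}$ and $N[v]=N(v)\cup\{v\}$. A signed Roman domination (SRD) function on $G$ is a function $f:V\to\{-1,1,2\}$ such that (i) $\sum_{u\in N[v]}f(u)\geq 1$ for every $v\in V$, and (ii) every $v\in V$ with $f(v)=-1$ has a neighbor $u\in N(v)$ with $f(u)=2$. The weight of $f$ is $f(V)=\sum_{v\in V}f(v)$, and the signed Roman domination number $\gamma_{sR}(G)$ is the minimum weight of an SRD function on $G$. The graph $A_n$ has $3n$ distinct vertices $V(A_n)=\{a_i,b_i,c_i\mid i=0,\ldots,n-1\}$ and edge set $E(A_n)=\{a_ia_{i+1},\,b_ib_{i+1},\,c_ic_{i+1},\,a_ib_i,\,b_ic_i,\,a_{i+1}b_i,\,b_{i+1}c_i\mid i=0,\ldots,n-1\}$, with vertex indices taken modulo $n$. *)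

theory Defs
  imports "HOL-Library.FuncSet"
begin

text \<open>
  A finite simple undirected graph is given by its vertex set and its set of
  edges, the latter being two-element sets of vertices.
\<close>

definition simple_graph :: "'v set \<Rightarrow> 'v set set \<Rightarrow> bool" where
  "simple_graph V E \<longleftrightarrow> finite V \<and> (\<forall>e\<in>E. e \<subseteq> V \<and> card e = 2)"

definition nbhd :: "'v set \<Rightarrow> 'v set set \<Rightarrow> 'v \<Rightarrow> 'v set" where
  "nbhd V E v = {u \<in> V. {u, v} \<in> E}"

definition closed_nbhd :: "'v set \<Rightarrow> 'v set set \<Rightarrow> 'v \<Rightarrow> 'v set" where
  "closed_nbhd V E v = nbhd V E v \<union> {v}"

text \<open>Values of \<open>f\<close> outside \<open>V\<close> are irrelevant.\<close>

definition srd_function :: "'v set \<Rightarrow> 'v set set \<Rightarrow> ('v \<Rightarrow> int) \<Rightarrow> bool" where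
  "srd_function V E f \<longleftrightarrow>
     f \<in> V \<rightarrow> {-1, 1, 2} \<and>
     (\<forall>v\<in>V. (\<Sum>u\<in>closed_nbhd V E v. f u) \<ge> 1) \<and>
     (\<forall>v\<in>V. f v = -1 \<longrightarrow> (\<exists>u\<in>nbhd V E v. f u = 2))"

definition weight :: "'v set \<Rightarrow> ('v \<Rightarrow> int) \<Rightarrow> int" where
  "weight V f = (\<Sum>v\<in>V. f v)"

definition signed_roman_domination_number :: "'v set \<Rightarrow> 'v set set \<Rightarrow> int" where
  "signed_roman_domination_number V E = Min {weight V f | f. srd_function V E f}"

text \<open>
  \<open>Min\<close> is only meaningful on finite nonempty sets; on finite simple graphs the
  set of weights is one, so the minimum is attained and is a lower bound.
\<close>

lemma finite_srd_weights:
  assumes "simple_graph V E"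
  shows "finite {weight V f | f. srd_function V E f}"
proof -
  have fin: "finite V"
    using assms by (simp add: simple_graph_def)
  have "weight V f \<in> weight V ` (V \<rightarrow>\<^sub>E {-1, 1, 2})" if "srd_function V E f" for f
  proof (rule image_eqI)
    show "weight V f = weight V (restrict f V)"
      by (simp add: weight_def)
    show "restrict f V \<in> V \<rightarrow>\<^sub>E {-1, 1, 2}"
      using that by (simp add: srd_function_def)
  qed
  then have "{weight V f | f. srd_function V E f} \<subseteq> weight V ` (V \<rightarrow>\<^sub>E {-1, 1, 2})"
    by blast
  moreover have "finite (V \<rightarrow>\<^sub>E {-1, 1, 2::int})"
    using fin by (intro finite_PiE) auto
  ultimately show ?thesis
    using finite_subset by blast
qed

lemma srd_function_const_1:
  assumes "simple_graph V E"
  shows "srd_function V E (\<lambda>_. 1)"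
proof -
  have "card (closed_nbhd V E v) > 0" for v
    using assms by (simp add: card_gt_0_iff closed_nbhd_def nbhd_def simple_graph_def)
  then show ?thesis
    by (simp add: srd_function_def Suc_le_eq)
qed

lemma signed_roman_domination_number_attained:
  assumes "simple_graph V E"
  shows "\<exists>f. srd_function V E f \<and> weight V f = signed_roman_domination_number V E"
proof -
  have "{weight V f | f. srd_function V E f} \<noteq> {}"
    using srd_function_const_1[OF assms] by blast
  from Min_in[OF finite_srd_weights[OF assms] this] show ?thesis
    by (auto simp: signed_roman_domination_number_def)
qed

lemma signed_roman_domination_number_le:
  assumes "simple_graph V E" and "srd_function V E f"
  shows "signed_roman_domination_number V E \<le> weight V f"
  unfolding signed_roman_domination_number_def
  using finite_srd_weights[OF assms(1)] assms(2) by (intro Min_le) auto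

datatype vertex = va nat | vb nat | vc nat

definition A_vertices :: "nat \<Rightarrow> vertex set" where
  "A_vertices n = (\<Union>i<n. {va i, vb i, vc i})"

definition A_edges :: "nat \<Rightarrow> vertex set set" where
  "A_edges n = (\<Union>i<n.
     {{va i, va ((i + 1) mod n)}, {vb i, vb ((i + 1) mod n)}, {vc i, vc ((i + 1) mod n)},
      {va i, vb i}, {vb i, vc i}, {va ((i + 1) mod n), vb i}, {vb ((i + 1) mod n), vc i}})"

lemma simple_graph_A:
  assumes "n \<ge> 2"
  shows "simple_graph (A_vertices n) (A_edges n)"
proof -
  have "i \<noteq> (i + 1) mod n" if "i < n" for i
    using assms that by (cases "i + 1 = n") auto
  moreover have "(i + 1) mod n < n" for i
    using assms by simp
  ultimately show ?thesis
    unfolding simple_graph_def A_vertices_def A_edges_def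
    by (auto simp: card_2_iff doubleton_eq_iff)
qed

end

theory Submission imports Defs begin

text \<open>
  Summing the domination condition over all \<open>a\<^sub>i\<close> and all \<open>c\<^sub>i\<close> gives
  \<open>3 A + 2 B \<ge> n\<close> and \<open>3 C + 2 B \<ge> n\<close>, where \<open>A\<close>, \<open>B\<close>, \<open>C\<close> are the weights of the
  three cycles. Hence \<open>3 (A + B + C) \<ge> 2 n - B\<close>, which is nonnegative because \<open>f \<le> 2\<close>.
  The value \<open>0\<close> is attained by assigning \<open>2\<close> to every \<open>b\<^sub>i\<close> and \<open>-1\<close> elsewhere.
\<close>

definition cyc_succ :: "nat \<Rightarrow> nat \<Rightarrow> nat" where
  "cyc_succ n i = (i + 1) mod n"

text \<open>The \<open>n\<close> is added before 1 is subtracted because natural subtraction would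
  truncate at \<open>i = 0\<close>.\<close>

definition cyc_pred :: "nat \<Rightarrow> nat \<Rightarrow> nat" where
  "cyc_pred n i = (i + n - 1) mod n"

lemma cyc_less:
  assumes "i < n"
  shows "cyc_succ n i < n" and "cyc_pred n i < n"
  using assms by (simp_all add: cyc_succ_def cyc_pred_def)

lemma cyc_pred_eq_if: "i < n \<Longrightarrow> cyc_pred n i = (if i = 0 then n - 1 else i - 1)"
  by (cases i) (auto simp: cyc_pred_def)

lemma cyc_succ_eq_if: "i < n \<Longrightarrow> cyc_succ n i = (if i + 1 = n then 0 else i + 1)"
  by (auto simp: cyc_succ_def)

text \<open>Turns an edge seen from its far end, where the index appears as a successor, into a
  condition on the predecessor.\<close>

lemma cyc_succ_eq_iff:
  assumes "i < n" "j < n"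
  shows "i = cyc_succ n j \<longleftrightarrow> j = cyc_pred n i"
  using assms by (auto simp: cyc_pred_eq_if cyc_succ_eq_if)

text \<open>Ensures that the vertices listed in \<open>closed_nbhd_A\<close> do not repeat, so that
  sums over these sets split into five or seven terms. For \<open>n = 2\<close> successor and
  predecessor coincide.\<close>

lemma cyc_distinct:
  assumes "n \<ge> 3" "i < n"
  shows "cyc_succ n i \<noteq> i" "cyc_pred n i \<noteq> i" "cyc_succ n i \<noteq> cyc_pred n i"
  using assms by (auto simp: cyc_pred_eq_if cyc_succ_eq_if)

lemma cyc_inverse:
  assumes "i < n"
  shows "cyc_succ n (cyc_pred n i) = i" "cyc_pred n (cyc_succ n i) = i"
  using assms cyc_less[OF assms] cyc_succ_eq_iff[of i n "cyc_pred n i"]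
    cyc_succ_eq_iff[of "cyc_succ n i" n i] by auto

text \<open>Both shifts permute the indices below \<open>n\<close>, each being the inverse of the
  other.\<close>

lemma sum_cyc:
  shows "(\<Sum>i<n. g (cyc_succ n i)) = (\<Sum>i<n. g i)"
    and "(\<Sum>i<n. g (cyc_pred n i)) = (\<Sum>i<n. g i)"
proof -
  show "(\<Sum>i<n. g (cyc_succ n i)) = (\<Sum>i<n. g i)"
    by (rule sum.reindex_bij_witness[where i = "cyc_pred n" and j = "cyc_succ n"])
       (auto simp: cyc_less cyc_inverse)
  show "(\<Sum>i<n. g (cyc_pred n i)) = (\<Sum>i<n. g i)"
    by (rule sum.reindex_bij_witness[where i = "cyc_succ n" and j = "cyc_pred n"])
       (auto simp: cyc_less cyc_inverse)
qed

lemma vertex_in_A [simp]: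
  "va i \<in> A_vertices n \<longleftrightarrow> i < n"
  "vb i \<in> A_vertices n \<longleftrightarrow> i < n"
  "vc i \<in> A_vertices n \<longleftrightarrow> i < n"
  by (auto simp: A_vertices_def)

text \<open>The generating edges step forward to \<open>i + 1\<close>; read from the other end they
  step back. Hence the diagonals give \<open>cyc_succ\<close> in one direction and
  \<open>cyc_pred\<close> in the other.\<close>

lemma A_edge_iff:
  assumes "i < n" "j < n"
  shows "{va j, va i} \<in> A_edges n \<longleftrightarrow> j = cyc_succ n i \<or> j = cyc_pred n i"
    and "{vb j, vb i} \<in> A_edges n \<longleftrightarrow> j = cyc_succ n i \<or> j = cyc_pred n i"
    and "{vc j, vc i} \<in> A_edges n \<longleftrightarrow> j = cyc_succ n i \<or> j = cyc_pred n i"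
    and "{va j, vb i} \<in> A_edges n \<longleftrightarrow> j = i \<or> j = cyc_succ n i"
    and "{vb j, va i} \<in> A_edges n \<longleftrightarrow> j = i \<or> j = cyc_pred n i"
    and "{vb j, vc i} \<in> A_edges n \<longleftrightarrow> j = i \<or> j = cyc_succ n i"
    and "{vc j, vb i} \<in> A_edges n \<longleftrightarrow> j = i \<or> j = cyc_pred n i"
    and "{va j, vc i} \<notin> A_edges n"
    and "{vc j, va i} \<notin> A_edges n"
  using assms cyc_succ_eq_iff[of i n j] cyc_succ_eq_iff[of j n i]
  unfolding A_edges_def cyc_succ_def[symmetric]
  by (auto simp: doubleton_eq_iff)

lemma closed_nbhd_A:
  assumes "i < n"
  shows "closed_nbhd (A_vertices n) (A_edges n) (va i) =
      {va i, va (cyc_succ n i), va (cyc_pred n i), vb i, vb (cyc_pred n i)}" (is ?a)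
    and "closed_nbhd (A_vertices n) (A_edges n) (vb i) =
      {vb i, vb (cyc_succ n i), vb (cyc_pred n i), va i, va (cyc_succ n i), vc i, vc (cyc_pred n i)}" (is ?b)
    and "closed_nbhd (A_vertices n) (A_edges n) (vc i) =
      {vc i, vc (cyc_succ n i), vc (cyc_pred n i), vb i, vb (cyc_succ n i)}" (is ?c)
proof -
  \<comment> \<open>Extensionality split by constructor puts every membership question into a form
    that \<open>A_edge_iff\<close> decides.\<close>
  have *: "S = T" if "\<And>j. va j \<in> S \<longleftrightarrow> va j \<in> T" "\<And>j. vb j \<in> S \<longleftrightarrow> vb j \<in> T"
    "\<And>j. vc j \<in> S \<longleftrightarrow> vc j \<in> T" for S T
    using that by (metis set_eqI vertex.exhaust)
  show ?a ?b ?c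
    using assms cyc_less[OF assms]
    by (intro *; auto simp: closed_nbhd_def nbhd_def A_edge_iff)+
qed

lemma sum_A_vertices:
  fixes f :: "vertex \<Rightarrow> int"
  shows "(\<Sum>v\<in>A_vertices n. f v) = (\<Sum>i<n. f (va i)) + (\<Sum>i<n. f (vb i)) + (\<Sum>i<n. f (vc i))"
proof -
  have "(\<Sum>v\<in>A_vertices n. f v) = (\<Sum>i<n. \<Sum>v\<in>{va i, vb i, vc i}. f v)"
    unfolding A_vertices_def by (rule sum.UNION_disjoint) auto
  then show ?thesis
    by (simp add: sum.distrib add.assoc)
qed

lemma srd_weight_A_nonneg:
  assumes "n \<ge> 3" and f: "srd_function (A_vertices n) (A_edges n) f"
  shows "weight (A_vertices n) f \<ge> 0"
proof -
  let ?A = "\<Sum>i<n. f (va i)" and ?B = "\<Sum>i<n. f (vb i)" and ?C = "\<Sum>i<n. f (vc i)"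
  let ?N = "closed_nbhd (A_vertices n) (A_edges n)"
  have dom: "(\<Sum>u\<in>?N v. f u) \<ge> 1" if "v \<in> A_vertices n" for v
    using f that by (simp add: srd_function_def)
  have le2: "f v \<le> 2" if "v \<in> A_vertices n" for v
    using f that by (auto simp: srd_function_def dest!: funcset_mem[of f])
  have "int n = (\<Sum>i<n. 1)"
    by simp
  also have "\<dots> \<le> (\<Sum>i<n. \<Sum>u\<in>?N (va i). f u)"
    by (intro sum_mono dom) simp
  also have "\<dots> = (\<Sum>i<n. f (va i) + f (va (cyc_succ n i)) + f (va (cyc_pred n i))
      + f (vb i) + f (vb (cyc_pred n i)))"
    using cyc_distinct[OF assms(1)] by (intro sum.cong) (force simp: closed_nbhd_A)+
  \<comment> \<open>Double counting: shifts preserve sums over the cycle, so the three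
    \<open>va\<close> terms each contribute \<open>?A\<close> and the two \<open>vb\<close> terms
    each contribute \<open>?B\<close>.\<close>
  also have "\<dots> = 3 * ?A + 2 * ?B"
    by (simp add: sum.distrib sum_cyc[of "\<lambda>i. f (va i)"] sum_cyc[of "\<lambda>i. f (vb i)"])
  finally have a: "int n \<le> 3 * ?A + 2 * ?B" .
  have "int n = (\<Sum>i<n. 1)"
    by simp
  also have "\<dots> \<le> (\<Sum>i<n. \<Sum>u\<in>?N (vc i). f u)"
    by (intro sum_mono dom) simp
  also have "\<dots> = (\<Sum>i<n. f (vc i) + f (vc (cyc_succ n i)) + f (vc (cyc_pred n i))
      + f (vb i) + f (vb (cyc_succ n i)))"
    using cyc_distinct[OF assms(1)] by (intro sum.cong) (force simp: closed_nbhd_A)+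
  also have "\<dots> = 3 * ?C + 2 * ?B"
    by (simp add: sum.distrib sum_cyc[of "\<lambda>i. f (vc i)"] sum_cyc[of "\<lambda>i. f (vb i)"])
  finally have c: "int n \<le> 3 * ?C + 2 * ?B" .
  have "?B \<le> (\<Sum>i<n. 2)"
    by (intro sum_mono le2) simp
  with a c show ?thesis
    by (simp add: weight_def sum_A_vertices)
qed

definition b_cycle_srd :: "vertex \<Rightarrow> int" where
  "b_cycle_srd v = (case v of vb _ \<Rightarrow> 2 | _ \<Rightarrow> -1)"

lemma b_cycle_srd_simps [simp]:
  "b_cycle_srd (va i) = -1" "b_cycle_srd (vb i) = 2" "b_cycle_srd (vc i) = -1"
  by (simp_all add: b_cycle_srd_def)

lemma weight_b_cycle_srd: "weight (A_vertices n) b_cycle_srd = 0"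
  by (simp add: weight_def sum_A_vertices)

text \<open>The closed neighbourhood sums are \<open>2 * 2 - 3 = 1\<close> at \<open>va i\<close>
  and \<open>vc i\<close>, and \<open>3 * 2 - 4 = 2\<close> at \<open>vb i\<close>.\<close>

lemma srd_function_b_cycle:
  assumes "n \<ge> 3"
  shows "srd_function (A_vertices n) (A_edges n) b_cycle_srd"
proof -
  have "(\<Sum>u\<in>closed_nbhd (A_vertices n) (A_edges n) v. b_cycle_srd u) \<ge> 1"
    and "b_cycle_srd v = -1 \<longrightarrow> (\<exists>u\<in>nbhd (A_vertices n) (A_edges n) v. b_cycle_srd u = 2)"
    if v: "v \<in> A_vertices n" for v
  proof -
    obtain i where i: "i < n" "v = va i \<or> v = vb i \<or> v = vc i"
      using v by (auto simp: A_vertices_def)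
    note distinct = cyc_distinct[OF assms i(1)] cyc_distinct[OF assms i(1), symmetric]
    show "(\<Sum>u\<in>closed_nbhd (A_vertices n) (A_edges n) v. b_cycle_srd u) \<ge> 1"
      using i(2) distinct by (auto simp: closed_nbhd_A[OF i(1)])
    \<comment> \<open>The vertical edges join \<open>va i\<close> and \<open>vc i\<close> to
      \<open>vb i\<close>, which has value 2.\<close>
    have "vb i \<in> nbhd (A_vertices n) (A_edges n) v" if "v \<noteq> vb i"
      using that i by (auto simp: nbhd_def A_edge_iff)
    then show "b_cycle_srd v = -1 \<longrightarrow> (\<exists>u\<in>nbhd (A_vertices n) (A_edges n) v. b_cycle_srd u = 2)"
      using i(2) by force
  qed
  moreover have "b_cycle_srd \<in> A_vertices n \<rightarrow> {-1, 1, 2}"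
    by (auto simp: b_cycle_srd_def split: vertex.split)
  ultimately show ?thesis
    by (simp add: srd_function_def)
qed

theorem theorem1:
  fixes n :: nat
  assumes "n \<ge> 5"
  shows "signed_roman_domination_number (A_vertices n) (A_edges n) = 0"
proof -
  have simple: "simple_graph (A_vertices n) (A_edges n)"
    using assms by (intro simple_graph_A) simp
  show ?thesis
  proof (rule antisym)
    show "signed_roman_domination_number (A_vertices n) (A_edges n) \<le> 0"
      using signed_roman_domination_number_le[OF simple srd_function_b_cycle] assms
      by (simp add: weight_b_cycle_srd)
    \<comment> \<open>The minimum is the weight of some SRD function, so the bound for all such
      weights applies to it.\<close>
    show "0 \<le> signed_roman_domination_number (A_vertices n) (A_edges n)"
      using signed_roman_domination_number_attained[OF simple] srd_weight_A_nonneg[of n] assms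
      by force
  qed
qed

end
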